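(* Let $A(t)=\int_0^t a(s)\,ds$, $t>0$, be a Young function satisfying $$\int_{\mathbb{R}_+}A\left(\frac{k}{1+t}\right)dt<\infty$$ for some $k>0$ (equivalently, $\int_0^k A(s)\,s^{-2}\,ds<\infty$). Set $$\mathcal A(t)=t\int_0^t a(s)\,\frac{ds}{s},\quad t>0,\qquad\text{and}\qquad \rho_{\Gamma_{\mathcal A}}(f)=\rho_A(Pf^* ).$$ Then $\mathcal A$ is a Young function satisfying $$\tfrac12\,\rho_{\Gamma_{\mathcal A}}(f)\le \rho_{\mathcal A}(f)\le \rho_{\Gamma_{\mathcal A}}(f)\qquad\text{for all } f\in\mathfrak M(\mathbb{R}_+).$$
   Context: $\mathbb{R}_+=(0,\infty)$ with Lebesgue measure; $\mathfrak M(\mathbb{R}_+)$ is the set of measurable real-valued functions on $\mathbb{R}_+$. A Young function is a function $A(t)=\int_0^t a(s)\,ds$, $t\in\mathbb{R}_+$, where $a$ is a nondecreasing function mapping $\mathbb{R}_+$ onto itself. For a Young function $A$, the Luxemburg--Orlicz norm is $\rho_A(f)=\inf\{\lambda>0:\int_{\mathbb{R}_+}A(|f(x)|/\lambda)\,dx\le 1\}$, with $\inf\emptyset=\infty$. The nonincreasing rearrangement of $f$ is $f^*(t)=\inf\{\lambda>0:|\{x\in\mathbb{R}_+:|f(x)|>\lambda\}|\le t\}$, $t\in\mathbb{R}_+$. The Hardy averaging operator is $(Pg)(t)=t^{-1}\int_0^t g(s)\,ds$, $t>0$, for nonnegative measurable $g$ on $\mathbb{R}_+$. *)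

theory Defs
  imports "HOL-Analysis.Analysis"
begin

text \<open>
  Every quantity below is nonnegative and some of them may be infinite (\<open>f\<^sup>*\<close>, \<open>P f\<^sup>*\<close>, the
  norms), so all values and integrals are taken in \<^typ>\<open>ennreal\<close>.
\<close>

abbreviation leb_pos :: "real measure" where
  "leb_pos \<equiv> lebesgue_on {0<..}"

definition young_density :: "(real \<Rightarrow> real) \<Rightarrow> bool" where
  "young_density a \<longleftrightarrow> mono_on {0<..} a \<and> a ` {0<..} = {0<..}"

text \<open>
  \<open>A(t) = \<integral>\<^sub>0\<^sup>t a(s) ds\<close>.  The argument ranges over \<^typ>\<open>ennreal\<close> because \<open>A\<close> is later evaluated
  at functions that may take the values \<open>0\<close> and \<open>\<infinity>\<close>; the same formula covers these values and,
  for the densities above, gives \<open>A(0) = 0\<close> and \<open>A(\<infinity>) = \<infinity>\<close>.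
\<close>

definition young_of :: "(real \<Rightarrow> real) \<Rightarrow> ennreal \<Rightarrow> ennreal" where
  "young_of a t = (\<integral>\<^sup>+ s\<in>{s. ennreal s < t}. ennreal (a s) \<partial>leb_pos)"

definition young_function :: "(ennreal \<Rightarrow> ennreal) \<Rightarrow> bool" where
  "young_function A \<longleftrightarrow> (\<exists>a. young_density a \<and> A = young_of a)"

text \<open>\<open>\<A>(t) = t \<integral>\<^sub>0\<^sup>t a(s) ds/s\<close>, with the same range of arguments.\<close>

definition cal_A :: "(real \<Rightarrow> real) \<Rightarrow> ennreal \<Rightarrow> ennreal" where
  "cal_A a t = t * (\<integral>\<^sup>+ s\<in>{s. ennreal s < t}. ennreal (a s / s) \<partial>leb_pos)"

text \<open>The infimum of the empty set in \<^typ>\<open>ennreal\<close> is \<open>\<infinity>\<close>, here and in the rearrangement.\<close>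

definition orlicz_norm :: "(ennreal \<Rightarrow> ennreal) \<Rightarrow> (real \<Rightarrow> ennreal) \<Rightarrow> ennreal" where
  "orlicz_norm A g =
     Inf {ennreal l | l. 0 < l \<and> (\<integral>\<^sup>+ x. A (g x / ennreal l) \<partial>leb_pos) \<le> 1}"

definition rearrangement :: "(real \<Rightarrow> real) \<Rightarrow> real \<Rightarrow> ennreal" where
  "rearrangement f t =
     Inf {ennreal l | l. 0 < l \<and> emeasure leb_pos {x \<in> {0<..}. l < \<bar>f x\<bar>} \<le> ennreal t}"

definition hardy_avg :: "(real \<Rightarrow> ennreal) \<Rightarrow> real \<Rightarrow> ennreal" where
  "hardy_avg g t = (\<integral>\<^sup>+ s\<in>{0<..<t}. g s \<partial>leb_pos) / ennreal t"

text \<open>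
  \<open>\<rho>\<^sub>A(f)\<close> for real-valued \<open>f\<close>, and \<open>\<rho>\<^sub>A(P f\<^sup>*)\<close>.  The latter is the norm written with
  the subscript \<open>\<Gamma>\<^sub>\<A>\<close>, although it is defined from \<open>A\<close>.
\<close>

definition rho :: "(ennreal \<Rightarrow> ennreal) \<Rightarrow> (real \<Rightarrow> real) \<Rightarrow> ennreal" where
  "rho A f = orlicz_norm A (\<lambda>x. ennreal \<bar>f x\<bar>)"

definition rho_Gamma :: "(ennreal \<Rightarrow> ennreal) \<Rightarrow> (real \<Rightarrow> real) \<Rightarrow> ennreal" where
  "rho_Gamma A f = orlicz_norm A (hardy_avg (rearrangement f))"

end

theory Submission
  imports Defs
begin

text \<open>
  By Tonelli's theorem every integral becomes an integral against the density \<open>a\<close>.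
  With \<open>J(v) = \<integral>\<^bsub>{|f| > v}\<^esub> |f|\<close>, which is the same for \<open>f\<close> and \<open>f\<^sup>*\<close>, one gets
  \<open>\<integral> \<A>(|f|/\<lambda>) = \<integral> a(s) J(\<lambda>s)/(\<lambda>s) ds\<close> and
  \<open>\<integral> A(P f\<^sup>*/\<lambda>) = \<integral> a(s) |{P f\<^sup>* > \<lambda>s}| ds\<close>.  The norm inequalities then follow from the weak-type
  estimates \<open>|{P f\<^sup>* > 2v}| \<le> J(v)/v \<le> |{P f\<^sup>* > v}|\<close>.
\<close>

text \<open>That \<open>cal_A\<close> is a Young function is a matter of its own. Differentiating
  \<open>t\<close> times the integral of \<open>a(s)/s\<close> over \<open>(0,t)\<close> gives the
  candidate density \<open>a(t)\<close> plus that integral. The integrability condition tames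
  \<open>a(s)/s\<close> near 0, which makes the candidate finite and lets it tend to 0 at 0;
  monotonicity of \<open>a\<close> then yields continuity, so that every positive value is attained.
  The recurring obstacle is that values may be 0 or infinite, so subtraction and division are
  delicate in \<open>ennreal\<close>. For this reason ranges of integration are written as
  \<open>{s. ennreal s < c}\<close> with an extended endpoint \<open>c\<close>, identities are kept
  in additive form, and a bound on a measure is proved by including an interval of that length in a
  level set, or the reverse. Both modulars integrate against the same \<open>a(s) ds\<close>, so
  they are compared level by level, with \<open>v = s * l\<close> at scale \<open>l\<close>. A
  constant in the level thus becomes a constant in the norm.\<close>

section \<open>Lebesgue measure on the half-line and the Tonelli exchange\<close>

lemma borel_measurable_leb_pos:
  "f \<in> borel_measurable borel \<Longrightarrow> f \<in> borel_measurable leb_pos"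
  by (intro measurable_restrict_space1 measurable_completion) simp

lemma sets_leb_pos_borel: "S \<in> sets borel \<Longrightarrow> S \<subseteq> {0<..} \<Longrightarrow> S \<in> sets leb_pos"
  by (auto simp: sets_restrict_space_iff)

lemma emeasure_leb_pos_borel:
  "S \<in> sets borel \<Longrightarrow> S \<subseteq> {0<..} \<Longrightarrow> emeasure leb_pos S = emeasure lborel S"
  by (simp add: emeasure_restrict_space)

lemma nn_integral_leb_pos:
  "(\<integral>\<^sup>+ x. f x \<partial>leb_pos) = (\<integral>\<^sup>+ x\<in>{0<..}. f x \<partial>lborel)"
  by (simp add: nn_integral_restrict_space nn_integral_completion)

lemma sigma_finite_leb_pos: "sigma_finite_measure leb_pos"
proof
  let ?A = "range (\<lambda>n::nat. {0<..real n})"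
  have "x \<in> \<Union>?A" if "0 < x" for x :: real
    using real_arch_simple[of x] that by auto
  then show "\<exists>A. countable A \<and> A \<subseteq> sets leb_pos \<and> \<Union>A = space leb_pos \<and> (\<forall>a\<in>A. emeasure leb_pos a \<noteq> \<infinity>)"
    by (intro exI[of _ ?A]) (auto simp: sets_leb_pos_borel emeasure_leb_pos_borel subset_iff)
qed

interpretation leb_pos: sigma_finite_measure leb_pos
  by (rule sigma_finite_leb_pos)

text \<open>The set is the interval from 0 to \<open>c\<close>. Any extended number thereby becomes
  the measure of an explicit set, so inequalities between measures and numbers reduce to
  inclusions.\<close>

lemma emeasure_leb_pos_less: "emeasure leb_pos {t \<in> {0<..}. ennreal t < c} = c"
proof (cases c)
  case (real r)
  then have "{t \<in> {0<..}. ennreal t < c} = {0<..<r}"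
    by (auto simp: ennreal_less_iff)
  with real show ?thesis by (subst emeasure_leb_pos_borel) auto
next
  case top
  have "emeasure lborel {0::real<..} = \<infinity>"
  proof (rule antisym)
    show "emeasure lborel {0::real<..} \<le> \<infinity>" by simp
    have "(SUP n. of_nat n) \<le> emeasure lborel {0::real<..}"
    proof (rule SUP_least)
      fix n :: nat
      have "emeasure lborel {0<..<real n} \<le> emeasure lborel {0::real<..}"
        by (rule emeasure_mono) auto
      then show "of_nat n \<le> emeasure lborel {0::real<..}"
        by (simp add: ennreal_of_nat_eq_real_of_nat)
    qed
    then show "\<infinity> \<le> emeasure lborel {0::real<..}"
      by (simp add: ennreal_SUP_of_nat_eq_top)
  qed
  moreover have "{t \<in> {0<..}. ennreal t < c} = {0<..}"
    using top by auto
  ultimately show ?thesis using top by (simp add: emeasure_leb_pos_borel)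
qed

text \<open>Superlevel sets of a monotone function are intervals. Rearrangements and integrals with
  a moving endpoint get their measurability in this way.\<close>

lemma borel_measurable_antitone_leb_pos:
  fixes g :: "real \<Rightarrow> ennreal"
  assumes "\<And>x y. 0 < x \<Longrightarrow> x \<le> y \<Longrightarrow> g y \<le> g x"
  shows "g \<in> borel_measurable leb_pos"
proof (rule borel_measurableI_greater)
  fix c
  let ?S = "{x \<in> {0<..}. c < g x}"
  have "is_interval ?S"
    unfolding is_interval_1 using assms by (auto intro: less_le_trans)
  then have "?S \<in> sets borel"
    by (rule real_interval_borel_measurable)
  then show "{x \<in> space leb_pos. c < g x} \<in> sets leb_pos"
    by (auto intro: sets_leb_pos_borel)
qed

lemma borel_measurable_monotone_leb_pos:
  fixes g :: "real \<Rightarrow> ennreal"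
  assumes "\<And>x y. 0 < x \<Longrightarrow> x \<le> y \<Longrightarrow> g x \<le> g y"
  shows "g \<in> borel_measurable leb_pos"
proof (rule borel_measurableI_greater)
  fix c
  let ?S = "{x \<in> {0<..}. c < g x}"
  have "is_interval ?S"
    unfolding is_interval_1 using assms by (fastforce intro: less_le_trans)
  then have "?S \<in> sets borel"
    by (rule real_interval_borel_measurable)
  then show "{x \<in> space leb_pos. c < g x} \<in> sets leb_pos"
    by (auto intro: sets_leb_pos_borel)
qed

text \<open>Tonelli on the region under the graph of \<open>g\<close>. The weight \<open>w\<close>
  allows one exchange to serve everywhere: \<open>w = 1\<close> gives the layer-cake formula for
  \<open>young_of\<close>, and \<open>w = g\<close> the one for \<open>cal_A\<close>.\<close>

lemma nn_integral_swap_less: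
  fixes \<phi> w g :: "real \<Rightarrow> ennreal"
  assumes [measurable]: "\<phi> \<in> borel_measurable leb_pos" "w \<in> borel_measurable leb_pos"
    "g \<in> borel_measurable leb_pos"
  shows "(\<integral>\<^sup>+ x. w x * (\<integral>\<^sup>+ s\<in>{s. ennreal s < g x}. \<phi> s \<partial>leb_pos) \<partial>leb_pos) =
    (\<integral>\<^sup>+ s. \<phi> s * (\<integral>\<^sup>+ x\<in>{x. ennreal s < g x}. w x \<partial>leb_pos) \<partial>leb_pos)"
proof -
  interpret pair_sigma_finite leb_pos leb_pos ..
  have [measurable]: "(\<lambda>s. ennreal s) \<in> borel_measurable leb_pos"
    by (rule borel_measurable_leb_pos) simp
  have [measurable]: "(\<lambda>(x, s). indicator {s. ennreal s < g x} s :: ennreal)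
      \<in> borel_measurable (leb_pos \<Otimes>\<^sub>M leb_pos)"
    unfolding indicator_def by measurable
  have "(\<integral>\<^sup>+ x. w x * (\<integral>\<^sup>+ s\<in>{s. ennreal s < g x}. \<phi> s \<partial>leb_pos) \<partial>leb_pos) =
      (\<integral>\<^sup>+ x. (\<integral>\<^sup>+ s. w x * (\<phi> s * indicator {s. ennreal s < g x} s) \<partial>leb_pos) \<partial>leb_pos)"
    by (intro nn_integral_cong nn_integral_cmult[symmetric]) measurable
  also have "\<dots> = (\<integral>\<^sup>+ s. (\<integral>\<^sup>+ x. w x * (\<phi> s * indicator {s. ennreal s < g x} s) \<partial>leb_pos) \<partial>leb_pos)"
    by (rule Fubini'[symmetric]) measurable
  also have "\<dots> = (\<integral>\<^sup>+ s. (\<integral>\<^sup>+ x. \<phi> s * (w x * indicator {x. ennreal s < g x} x) \<partial>leb_pos) \<partial>leb_pos)"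
    by (auto intro!: nn_integral_cong simp: indicator_def ac_simps)
  also have "\<dots> = (\<integral>\<^sup>+ s. \<phi> s * (\<integral>\<^sup>+ x\<in>{x. ennreal s < g x}. w x \<partial>leb_pos) \<partial>leb_pos)"
    by (intro nn_integral_cong nn_integral_cmult) (unfold indicator_def, measurable)
  finally show ?thesis .
qed

section \<open>Young densities, and lengths written as integrals\<close>

lemma young_density_mono: "young_density a \<Longrightarrow> 0 < s \<Longrightarrow> s \<le> t \<Longrightarrow> a s \<le> a t"
  by (auto simp: young_density_def mono_on_def)

lemma young_density_pos: "young_density a \<Longrightarrow> 0 < s \<Longrightarrow> 0 < a s"
  by (auto simp: young_density_def)

lemma young_density_surj: "young_density a \<Longrightarrow> 0 < y \<Longrightarrow> \<exists>s>0. a s = y"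
  unfolding young_density_def by (metis greaterThan_iff imageE)

lemma young_density_measurable:
  assumes "young_density a"
  shows "a \<in> borel_measurable leb_pos"
proof -
  have "(\<lambda>s. ennreal (a s)) \<in> borel_measurable leb_pos"
    by (rule borel_measurable_monotone_leb_pos)
      (auto intro!: ennreal_leI young_density_mono[OF assms])
  \<comment> \<open>The monotonicity criterion is about \<open>ennreal\<close> values; positivity of
    \<open>a\<close> on the half-line makes the way back to the reals lossless.\<close>
  then have "(\<lambda>s. enn2real (ennreal (a s))) \<in> borel_measurable leb_pos"
    by measurable
  also have "?this \<longleftrightarrow> ?thesis"
    using young_density_pos[OF assms] by (intro measurable_cong) (simp add: less_imp_le)
  finally show ?thesis .
qed

lemma set_nn_integral_leb_pos_one:
  assumes "{x \<in> {0<..}. P x} \<in> sets leb_pos"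
  shows "(\<integral>\<^sup>+ x\<in>{x. P x}. 1 \<partial>leb_pos) = emeasure leb_pos {x \<in> {0<..}. P x}"
proof -
  have "(\<integral>\<^sup>+ x\<in>{x. P x}. 1 \<partial>leb_pos) = (\<integral>\<^sup>+ x. indicator {x \<in> {0<..}. P x} x \<partial>leb_pos)"
    by (intro nn_integral_cong) (auto simp: indicator_def)
  with assms show ?thesis by simp
qed

lemma sets_leb_pos_less:
  assumes "g \<in> borel_measurable leb_pos" "h \<in> borel_measurable leb_pos"
  shows "{x \<in> {0<..}. g x < (h x :: ennreal)} \<in> sets leb_pos"
proof -
  have "{x \<in> space leb_pos. g x < h x} \<in> sets leb_pos"
    using assms by measurable
  then show ?thesis by simp
qed

text \<open>Presents an arbitrary extended value as an integral over \<open>s < c\<close>, the shape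
  to which \<open>nn_integral_swap_less\<close> applies.\<close>

lemma set_nn_integral_leb_pos_less: "(\<integral>\<^sup>+ s\<in>{s. ennreal s < c}. 1 \<partial>leb_pos) = c"
  by (subst set_nn_integral_leb_pos_one)
    (auto simp only: emeasure_leb_pos_less intro!: sets_leb_pos_less borel_measurable_leb_pos measurable_ennreal borel_measurable_const)

section \<open>Equivalence of the two integrability conditions\<close>

text \<open>The antiderivative is \<open>- 1 / s\<close>. For \<open>u >= k\<close> the range is
  empty, and the right-hand side is 0 too because \<open>ennreal\<close> truncates negative
  reals.\<close>

lemma nn_integral_inverse_square:
  assumes "0 < u" "0 < k"
  shows "(\<integral>\<^sup>+ s\<in>{s. ennreal u < ennreal s}. indicator {0<..<k} s / ennreal (s^2) \<partial>leb_pos) =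
    ennreal (1 / u - 1 / k)"
proof (cases "u < k")
  case True
  have "(\<integral>\<^sup>+ s\<in>{s. ennreal u < ennreal s}. indicator {0<..<k} s / ennreal (s^2) \<partial>leb_pos) =
      (\<integral>\<^sup>+ s. ennreal (1 / s^2) * indicator {u..k} s \<partial>lborel)"
    unfolding nn_integral_leb_pos
  \<comment> \<open>The endpoints \<open>u\<close> and \<open>k\<close> are discarded as null sets
    to pass to the closed interval required by the fundamental theorem of calculus.\<close>
  proof (rule nn_integral_cong_AE)
    show "AE s in lborel. indicator {0<..<k} s / ennreal (s^2) * indicator {s. ennreal u < ennreal s} s *
        indicator {0<..} s = ennreal (1 / s^2) * indicator {u..k} s"
      using AE_lborel_singleton[of u] AE_lborel_singleton[of k]
    proof eventually_elim
      case (elim s)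
      have "1 / ennreal (s^2) = ennreal (1 / s^2)" if "0 < s"
        using divide_ennreal[of 1 "s^2"] that by simp
      with elim assms show ?case
        by (auto simp: indicator_def ennreal_less_iff)
    qed
  qed
  also have "\<dots> = ennreal (- 1 / k - (- 1 / u))"
  proof (rule nn_integral_FTC_Icc)
    fix x assume "x \<in> {u..k}"
    with assms have "0 < x" by simp
    then show "((\<lambda>x. - 1 / x) has_real_derivative 1 / x^2) (at x)"
      by (auto intro!: derivative_eq_intros simp: field_simps power2_eq_square)
  qed (use True in auto)
  finally show ?thesis by simp
next
  case False
  have "(\<integral>\<^sup>+ s\<in>{s. ennreal u < ennreal s}. indicator {0<..<k} s / ennreal (s^2) \<partial>leb_pos) =
      (\<integral>\<^sup>+ s. 0 \<partial>leb_pos)"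
    using False assms by (intro nn_integral_cong) (auto simp: indicator_def ennreal_less_iff)
  moreover have "1 / u - 1 / k \<le> 0"
    using False assms by (simp add: field_simps)
  ultimately show ?thesis by (simp add: ennreal_neg)
qed

lemma nn_integral_young_of_shift:
  assumes a: "young_density a" and k: "0 < k"
  shows "(\<integral>\<^sup>+ t. young_of a (ennreal (k / (1 + t))) \<partial>leb_pos) =
    (\<integral>\<^sup>+ u. ennreal (a u) * ennreal (k / u - 1) \<partial>leb_pos)"
proof -
  note [measurable] = young_density_measurable[OF a]
  have g [measurable]: "(\<lambda>t. ennreal (k / (1 + t))) \<in> borel_measurable leb_pos"
    by (rule borel_measurable_leb_pos) measurable
  have "(\<integral>\<^sup>+ t. young_of a (ennreal (k / (1 + t))) \<partial>leb_pos) =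
      (\<integral>\<^sup>+ u. ennreal (a u) * (\<integral>\<^sup>+ t\<in>{t. ennreal u < ennreal (k / (1 + t))}. 1 \<partial>leb_pos) \<partial>leb_pos)"
    using nn_integral_swap_less[of "\<lambda>s. ennreal (a s)" "\<lambda>_. 1" "\<lambda>t. ennreal (k / (1 + t))"]
    by (simp add: young_of_def)
  also have "\<dots> = (\<integral>\<^sup>+ u. ennreal (a u) * ennreal (k / u - 1) \<partial>leb_pos)"
  proof (intro nn_integral_cong arg_cong2[where f = "(*)"] refl)
    fix u assume "u \<in> space leb_pos"
    then have u: "0 < u" by simp
    \<comment> \<open>Solving \<open>u < k / (1 + t)\<close> for \<open>t\<close>. If
      \<open>u >= k\<close>, both sets are empty.\<close>
    have "{t \<in> {0<..}. ennreal u < ennreal (k / (1 + t))} = {t \<in> {0<..}. ennreal t < ennreal (k / u - 1)}"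
      using u k by (auto simp: ennreal_less_iff field_simps)
    then show "(\<integral>\<^sup>+ t\<in>{t. ennreal u < ennreal (k / (1 + t))}. 1 \<partial>leb_pos) = ennreal (k / u - 1)"
      using measurable_sets[OF g, of "{ennreal u<..}"]
      emeasure_leb_pos_less[of "ennreal (k / u - 1)"]
      by (subst set_nn_integral_leb_pos_one) (simp_all add: vimage_def Int_def conj_commute)
  qed
  finally show ?thesis .
qed

lemma nn_integral_young_of_div_square:
  assumes a: "young_density a" and k: "0 < k"
  shows "(\<integral>\<^sup>+ s\<in>{0<..<k}. young_of a (ennreal s) / ennreal (s^2) \<partial>leb_pos) =
    (\<integral>\<^sup>+ u. ennreal (a u) * ennreal (1 / u - 1 / k) \<partial>leb_pos)"
proof -
  note [measurable] = young_density_measurable[OF a]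
  have [measurable]: "(\<lambda>t. ennreal t) \<in> borel_measurable leb_pos"
    by (rule borel_measurable_leb_pos) measurable
  have [measurable]: "(\<lambda>s. indicator {0<..<k} s / ennreal (s^2)) \<in> borel_measurable leb_pos"
    by (rule borel_measurable_leb_pos) measurable
  have "(\<integral>\<^sup>+ s\<in>{0<..<k}. young_of a (ennreal s) / ennreal (s^2) \<partial>leb_pos) =
      (\<integral>\<^sup>+ s. indicator {0<..<k} s / ennreal (s^2) * young_of a (ennreal s) \<partial>leb_pos)"
    by (intro nn_integral_cong) (simp add: divide_ennreal_def ac_simps)
  also have "\<dots> = (\<integral>\<^sup>+ u. ennreal (a u) *
      (\<integral>\<^sup>+ s\<in>{s. ennreal u < ennreal s}. indicator {0<..<k} s / ennreal (s^2) \<partial>leb_pos) \<partial>leb_pos)"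
    unfolding young_of_def by (rule nn_integral_swap_less) measurable
  also have "\<dots> = (\<integral>\<^sup>+ u. ennreal (a u) * ennreal (1 / u - 1 / k) \<partial>leb_pos)"
    using k by (intro nn_integral_cong) (simp add: nn_integral_inverse_square)
  finally show ?thesis .
qed

text \<open>After the exchange the two weights are \<open>k / u - 1\<close> and
  \<open>1 / u - 1 / k\<close>, which differ by the factor \<open>k\<close>. The equivalence is
  therefore an identity for each individual \<open>k\<close>.\<close>

lemma nn_integral_young_of_shift_eq:
  assumes a: "young_density a" and k: "0 < k"
  shows "(\<integral>\<^sup>+ t. young_of a (ennreal (k / (1 + t))) \<partial>leb_pos) =
    ennreal k * (\<integral>\<^sup>+ s\<in>{0<..<k}. young_of a (ennreal s) / ennreal (s^2) \<partial>leb_pos)"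
proof -
  have [measurable]: "a \<in> borel_measurable leb_pos" "(\<lambda>u. 1 / u - 1 / k) \<in> borel_measurable leb_pos"
    by (auto intro: young_density_measurable[OF a] borel_measurable_leb_pos)
  have "ennreal (k / u - 1) = ennreal k * ennreal (1 / u - 1 / k)" for u
    using k by (simp add: ennreal_mult'[symmetric] right_diff_distrib)
  then have "(\<integral>\<^sup>+ u. ennreal (a u) * ennreal (k / u - 1) \<partial>leb_pos) =
      (\<integral>\<^sup>+ u. ennreal k * (ennreal (a u) * ennreal (1 / u - 1 / k)) \<partial>leb_pos)"
    by (simp add: ac_simps)
  also have "\<dots> = ennreal k * (\<integral>\<^sup>+ u. ennreal (a u) * ennreal (1 / u - 1 / k) \<partial>leb_pos)"
    by (rule nn_integral_cmult) measurable
  finally show ?thesis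
    using assms by (simp only: nn_integral_young_of_shift nn_integral_young_of_div_square)
qed

section \<open>The integral of \<open>a(s)/s\<close>: local bounds, finiteness, decay at 0\<close>

text \<open>Named separately because it is both a factor of \<open>cal_A\<close> and a summand of
  its derivative.\<close>

definition log_mean :: "(real \<Rightarrow> real) \<Rightarrow> ennreal \<Rightarrow> ennreal" where
  "log_mean a t = (\<integral>\<^sup>+ s\<in>{s. ennreal s < t}. ennreal (a s / s) \<partial>leb_pos)"

lemma cal_A_eq: "cal_A a t = t * log_mean a t"
  by (simp add: cal_A_def log_mean_def)

lemma log_mean_mono: "s \<le> t \<Longrightarrow> log_mean a s \<le> log_mean a t"
  unfolding log_mean_def by (intro nn_integral_mono) (auto simp: indicator_def)

lemma quotient_measurable:
  assumes "young_density a"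
  shows "(\<lambda>s. ennreal (a s / s)) \<in> borel_measurable leb_pos"
proof -
  have [measurable]: "a \<in> borel_measurable leb_pos" "(\<lambda>s::real. s) \<in> borel_measurable leb_pos"
    by (auto intro: young_density_measurable[OF assms] borel_measurable_leb_pos)
  show ?thesis by measurable
qed

text \<open>On \<open>[x, y)\<close> the integrand is at most \<open>a y / x\<close>, since
  \<open>a\<close> increases and \<open>1 / s\<close> decreases. The bound carries finiteness from
  small arguments to all, and gives a local Lipschitz constant.\<close>

lemma log_mean_step:
  assumes a: "young_density a" and "0 < x" "x \<le> y"
  shows "log_mean a (ennreal y) \<le> log_mean a (ennreal x) + ennreal (a y / x * (y - x))"
proof -
  note [measurable] = quotient_measurable[OF a]
  have [measurable]: "(\<lambda>s. ennreal s) \<in> borel_measurable leb_pos"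
    by (rule borel_measurable_leb_pos) measurable
  have sub: "{x..<y} \<subseteq> {0<..}" using assms by auto
  then have [measurable]: "{x..<y} \<in> sets leb_pos"
    by (intro sets_leb_pos_borel) auto
  have ay: "0 < a y" using young_density_pos[OF a] assms by simp
  have "log_mean a (ennreal y) \<le> (\<integral>\<^sup>+ s. ennreal (a s / s) * indicator {s. ennreal s < ennreal x} s +
      ennreal (a y / x) * indicator {x..<y} s \<partial>leb_pos)"
    unfolding log_mean_def
  proof (rule nn_integral_mono)
    fix s assume "s \<in> space leb_pos"
    then have s: "0 < s" by simp
    have "a s / s \<le> a y / x" if "x \<le> s" "s < y"
      using that assms s ay young_density_mono[OF a, of s y] young_density_pos[OF a, of s]
      by (intro frac_le) auto
    then show "ennreal (a s / s) * indicator {s. ennreal s < ennreal y} s \<le>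
        ennreal (a s / s) * indicator {s. ennreal s < ennreal x} s + ennreal (a y / x) * indicator {x..<y} s"
      using s assms by (auto simp: indicator_def ennreal_less_iff intro!: ennreal_leI)
  qed
  also have "\<dots> = log_mean a (ennreal x) + (\<integral>\<^sup>+ s. ennreal (a y / x) * indicator {x..<y} s \<partial>leb_pos)"
    unfolding log_mean_def by (intro nn_integral_add) (unfold indicator_def, measurable)
  also have "(\<integral>\<^sup>+ s. ennreal (a y / x) * indicator {x..<y} s \<partial>leb_pos) = ennreal (a y / x * (y - x))"
    using assms ay sub
    by (simp add: nn_integral_cmult_indicator emeasure_leb_pos_borel ennreal_mult'[symmetric])
  finally show ?thesis .
qed

lemma log_mean_finite:
  assumes a: "young_density a" and k: "0 < k"
    and fin: "(\<integral>\<^sup>+ t. young_of a (ennreal (k / (1 + t))) \<partial>leb_pos) < \<infinity>"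
  shows "log_mean a (ennreal t) < \<infinity>"
proof -
  \<comment> \<open>The weight \<open>k / u - 1\<close> vanishes at \<open>u = k\<close>, so the
    comparison stops earlier; for \<open>u < k / 2\<close> the weight is at least
    \<open>k / (2 * u)\<close>, which is the source of the factor \<open>2 / k\<close>.\<close>
  let ?h = "k / 2"
  have [measurable]: "a \<in> borel_measurable leb_pos" "(\<lambda>u. k / u - 1) \<in> borel_measurable leb_pos"
    by (auto intro: young_density_measurable[OF a] borel_measurable_leb_pos)
  have "log_mean a (ennreal ?h) \<le> (\<integral>\<^sup>+ u. ennreal (2 / k) * (ennreal (a u) * ennreal (k / u - 1)) \<partial>leb_pos)"
    unfolding log_mean_def
  proof (rule nn_integral_mono)
    fix u assume "u \<in> space leb_pos"
    then have u: "0 < u" by simp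
    have "a u / u \<le> 2 / k * (a u * (k / u - 1))" if "u < ?h"
    proof -
      have "a u * (2 * u) \<le> a u * k"
        using that u young_density_pos[OF a u] by (intro mult_left_mono) auto
      then show ?thesis using u k by (simp add: field_simps)
    qed
    moreover have "0 \<le> k / u - 1" if "u < ?h" using that u k by (simp add: field_simps)
    ultimately show "ennreal (a u / u) * indicator {s. ennreal s < ennreal ?h} u \<le>
        ennreal (2 / k) * (ennreal (a u) * ennreal (k / u - 1))"
      using u k young_density_pos[OF a u]
      by (auto simp: indicator_def ennreal_less_iff ennreal_mult[symmetric] intro!: ennreal_leI)
  qed
  also have "\<dots> = ennreal (2 / k) * (\<integral>\<^sup>+ u. ennreal (a u) * ennreal (k / u - 1) \<partial>leb_pos)"
    by (rule nn_integral_cmult) measurable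
  also have "\<dots> < \<infinity>"
    using fin unfolding nn_integral_young_of_shift[OF a k]
    by (simp add: ennreal_mult_less_top)
  finally have h: "log_mean a (ennreal ?h) < \<infinity>" .
  show ?thesis
  proof (cases "t \<le> ?h")
    case True
    then have "log_mean a (ennreal t) \<le> log_mean a (ennreal ?h)"
      by (intro log_mean_mono ennreal_leI)
    with h show ?thesis by (rule le_less_trans[rotated])
  next
    case False
    then have "log_mean a (ennreal t) \<le> log_mean a (ennreal ?h) + ennreal (a t / ?h * (t - ?h))"
      using k by (intro log_mean_step[OF a]) auto
    also have "\<dots> < \<infinity>" using h by simp
    finally show ?thesis .
  qed
qed

text \<open>Continuity from above of the measure with density \<open>a(s)/s\<close>, which is finite
  on the intervals shrinking to the empty set. It supplies the small values needed for surjectivity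
  of the new density.\<close>

lemma log_mean_small:
  assumes a: "young_density a" and fin: "\<And>t. log_mean a (ennreal t) < \<infinity>" and e: "0 < e"
  shows "\<exists>t>0. log_mean a (ennreal t) < ennreal e"
proof -
  let ?M = "density leb_pos (\<lambda>s. ennreal (a s / s))"
  let ?S = "\<lambda>n::nat. {0<..<1 / (real n + 1)}"
  have S: "?S n \<in> sets leb_pos" for n
    by (intro sets_leb_pos_borel) auto
  have eq: "emeasure ?M (?S n) = log_mean a (ennreal (1 / (real n + 1)))" for n
    unfolding log_mean_def emeasure_density[OF quotient_measurable[OF a] S]
    by (intro nn_integral_cong) (auto simp: indicator_def ennreal_less_iff)
  have "decseq ?S"
  proof (rule antimonoI)
    fix m n :: nat assume "m \<le> n"
    then have "1 / (real n + 1) \<le> 1 / (real m + 1)" by (simp add: frac_le)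
    then show "?S n \<subseteq> ?S m" by auto
  qed
  then have "(\<lambda>n. emeasure ?M (?S n)) \<longlonglongrightarrow> emeasure ?M (\<Inter>n. ?S n)"
    using S fin by (intro Lim_emeasure_decseq) (auto simp: eq less_top)
  also have "(\<Inter>n. ?S n) = {}"
  proof -
    have "\<exists>n. \<not> x < 1 / (real n + 1)" if "0 < x" for x
      using reals_Archimedean[OF that] by (auto simp: inverse_eq_divide add.commute not_less intro: less_imp_le)
    then show ?thesis
      by (intro equals0I) (metis INT_D UNIV_I greaterThanLessThan_iff)
  qed
  finally have "(\<lambda>n. emeasure ?M (?S n)) \<longlonglongrightarrow> 0"
    by (simp only: emeasure_empty)
  then have "(\<lambda>n. log_mean a (ennreal (1 / (real n + 1)))) \<longlonglongrightarrow> 0"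
    by (simp only: eq)
  then have "\<forall>\<^sub>F n in sequentially. log_mean a (ennreal (1 / (real n + 1))) < ennreal e"
    using e by (intro order_tendstoD) auto
  then obtain n where "log_mean a (ennreal (1 / (real n + 1))) < ennreal e"
    by (auto dest: eventually_happens)
  then show ?thesis by (intro exI[of _ "1 / (real n + 1)"]) auto
qed

section \<open>\<open>cal_A\<close> as a Young function\<close>

text \<open>The derivative of \<open>t * log_mean a t\<close> by the product rule: the term
  \<open>t * (a t / t)\<close> is \<open>a t\<close>. The use of \<open>enn2real\<close> is faithful
  once \<open>log_mean\<close> is finite.\<close>

definition cal_density :: "(real \<Rightarrow> real) \<Rightarrow> real \<Rightarrow> real" where
  "cal_density a t = a t + enn2real (log_mean a (ennreal t))"

lemma young_density_cal_density:
  assumes a: "young_density a" and fin: "\<And>t. log_mean a (ennreal t) < \<infinity>"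
  shows "young_density (cal_density a)"
proof -
  let ?q = "\<lambda>t. enn2real (log_mean a (ennreal t))"
  have q_mono: "?q x \<le> ?q y" if "x \<le> y" for x y
    using that fin by (intro enn2real_mono log_mean_mono ennreal_leI) auto
  have mono: "cal_density a x \<le> cal_density a y" if "0 < x" "x \<le> y" for x y
    unfolding cal_density_def using that q_mono young_density_mono[OF a] by (intro add_mono)
  have q_step: "?q y \<le> ?q x + a y / x * (y - x)" if "0 < x" "x \<le> y" for x y
  proof -
    have "0 \<le> a y / x * (y - x)" using that young_density_pos[OF a, of y] by simp
    then have "ennreal (?q y) \<le> ennreal (?q x + a y / x * (y - x))"
      using log_mean_step[OF a that] fin[of x] fin[of y] by simp
    then show ?thesis
      using \<open>0 \<le> a y / x * (y - x)\<close> by (simp del: ennreal_plus)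
  qed
  have cont: "continuous_on {s..t} (cal_density a)" if st: "0 < s" "s \<le> t" for s t
  proof -
    \<comment> \<open>A monotone function whose range is an open interval cannot jump.\<close>
    have "continuous_on {0<..} a"
      using a by (intro continuous_onI_mono) (auto simp: young_density_def mono_on_def)
    then have "continuous_on {s..t} a"
      by (rule continuous_on_subset) (use st in auto)
    moreover have "continuous_on {s..t} ?q"
    proof (rule lipschitz_on_continuous_on)
      show "(a t / s)-lipschitz_on {s..t} ?q"
      proof (rule lipschitz_on_leI)
        fix x y assume xy: "x \<in> {s..t}" "y \<in> {s..t}" "x \<le> y"
        have "a y / x \<le> a t / s"
          using xy st young_density_mono[OF a, of y t] young_density_pos[OF a, of t] by (intro frac_le) auto
        then have "a y / x * (y - x) \<le> a t / s * (y - x)"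
          using xy by (intro mult_right_mono) auto
        then show "dist (?q x) (?q y) \<le> a t / s * dist x y"
          using q_step[of x y] q_mono[of x y] xy st by (simp add: dist_real_def)
      qed (use st young_density_pos[OF a, of t] in auto)
    qed
    ultimately show ?thesis
      unfolding cal_density_def by (intro continuous_on_add)
  qed
  have pos: "0 < cal_density a x" if "0 < x" for x
    using young_density_pos[OF a that] by (simp add: cal_density_def add_pos_nonneg)
  have "\<exists>x>0. cal_density a x = y" if y: "0 < y" for y
  proof -
    obtain t where t: "0 < t" "a t = y"
      using young_density_surj[OF a y] by auto
    \<comment> \<open>The target \<open>y\<close> is split into two halves, one for each summand of
      the density; at the smaller of \<open>s1\<close> and \<open>s2\<close> the sum is at most
      \<open>y\<close>. The intermediate value theorem then applies between that point and
      \<open>t\<close>.\<close>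
    obtain s1 where s1: "0 < s1" "a s1 = y / 2"
      using young_density_surj[OF a, of "y / 2"] y by auto
    obtain s2 where s2: "0 < s2" "log_mean a (ennreal s2) < ennreal (y / 2)"
      using log_mean_small[OF a fin, of "y / 2"] y by auto
    define s where "s = min s1 s2"
    have s: "0 < s" using s1 s2 by (simp add: s_def)
    have "?q s2 \<le> y / 2"
      using s2 y by (intro enn2real_leI) auto
    then have "cal_density a s \<le> y"
      using young_density_mono[OF a s, of s1] s1 q_mono[of s s2]
      by (simp add: cal_density_def s_def)
    moreover have "y \<le> cal_density a t"
      using t by (simp add: cal_density_def)
    moreover have "s \<le> t"
    proof (rule ccontr)
      assume "\<not> s \<le> t"
      then have "a t \<le> a s1" using t by (intro young_density_mono[OF a]) (auto simp: s_def)
      with t s1 y show False by simp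
    qed
    ultimately have "\<exists>x\<ge>s. x \<le> t \<and> cal_density a x = y"
      using cont[OF s] by (intro IVT')
    then obtain x where "s \<le> x" "cal_density a x = y" by blast
    with s show ?thesis by (intro exI[of _ x]) auto
  qed
  then have "{0<..} \<subseteq> cal_density a ` {0<..}" by fastforce
  with mono pos show ?thesis
    unfolding young_density_def mono_on_def by auto
qed

text \<open>Exchanging integrals turns the integral of \<open>log_mean\<close> over
  \<open>(0,t)\<close> into that of \<open>(a u / u) * (t - u)\<close>. The other summand
  contributes \<open>a u = (a u / u) * u\<close>, and the weights add up to
  \<open>t\<close>.\<close>

lemma young_of_cal_density:
  assumes a: "young_density a" and fin: "\<And>t. log_mean a (ennreal t) < \<infinity>"
  shows "young_of (cal_density a) t = cal_A a t"
proof -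
  have [measurable]: "a \<in> borel_measurable leb_pos" "(\<lambda>s. ennreal (a s / s)) \<in> borel_measurable leb_pos"
    "(\<lambda>s. ennreal s) \<in> borel_measurable leb_pos"
    by (auto intro: young_density_measurable[OF a] quotient_measurable[OF a] borel_measurable_leb_pos)
  have [measurable]: "(\<lambda>s. log_mean a (ennreal s)) \<in> borel_measurable leb_pos"
    by (intro borel_measurable_monotone_leb_pos log_mean_mono ennreal_leI)
  have [measurable]: "(\<lambda>s. indicator {s. ennreal s < t} s :: ennreal) \<in> borel_measurable leb_pos"
    unfolding indicator_def by measurable
  let ?E = "\<lambda>u. \<integral>\<^sup>+ x\<in>{x. ennreal u < ennreal x}. indicator {s. ennreal s < t} x \<partial>leb_pos"
  \<comment> \<open>\<open>?E u\<close> is the length \<open>t - u\<close>, stated additively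
    because \<open>t\<close> may be infinite.\<close>
  have E_le: "ennreal u + ?E u = t" if u: "0 < u" "ennreal u < t" for u
  proof -
    have [measurable]: "{0<..u} \<in> sets leb_pos"
      by (intro sets_leb_pos_borel) auto
    have "ennreal u = (\<integral>\<^sup>+ x. indicator {0<..u} x \<partial>leb_pos)"
      using u by (simp add: emeasure_leb_pos_borel subset_iff)
    then have "ennreal u + ?E u = (\<integral>\<^sup>+ x. indicator {0<..u} x +
        indicator {s. ennreal s < t} x * indicator {x. ennreal u < ennreal x} x \<partial>leb_pos)"
      by (subst nn_integral_add) (unfold indicator_def[of "{x. ennreal u < ennreal x}"], auto)
    also have "\<dots> = (\<integral>\<^sup>+ x\<in>{x. ennreal x < t}. 1 \<partial>leb_pos)"
    proof (rule nn_integral_cong)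
      fix x assume "x \<in> space leb_pos"
      moreover have "ennreal x < t" if "x \<le> u"
        using u(2) ennreal_leI[OF that] by (rule le_less_trans[rotated])
      ultimately show "indicator {0<..u} x + indicator {s. ennreal s < t} x * indicator {x. ennreal u < ennreal x} x =
          1 * (indicator {x. ennreal x < t} x :: ennreal)"
        using u by (auto simp: indicator_def ennreal_less_iff)
    qed
    also have "\<dots> = t"
      by (rule set_nn_integral_leb_pos_less)
    finally show ?thesis .
  qed
  have E_ge: "?E u = 0" if "\<not> ennreal u < t" for u
  proof -
    have "?E u = (\<integral>\<^sup>+ x. 0 \<partial>leb_pos)"
      using that by (intro nn_integral_cong) (auto simp: indicator_def)
    then show ?thesis by simp
  qed
  have [measurable]: "?E \<in> borel_measurable leb_pos"
    by (intro borel_measurable_antitone_leb_pos nn_integral_mono)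
      (auto simp: indicator_def intro: le_less_trans[OF ennreal_leI])
  have "young_of (cal_density a) t = (\<integral>\<^sup>+ s. ennreal (a s) * indicator {s. ennreal s < t} s +
      indicator {s. ennreal s < t} s * log_mean a (ennreal s) \<partial>leb_pos)"
    unfolding young_of_def cal_density_def
    using fin young_density_pos[OF a]
    by (intro nn_integral_cong) (auto simp: indicator_def less_imp_le)
  also have "\<dots> = (\<integral>\<^sup>+ s\<in>{s. ennreal s < t}. ennreal (a s) \<partial>leb_pos) +
      (\<integral>\<^sup>+ s. indicator {s. ennreal s < t} s * log_mean a (ennreal s) \<partial>leb_pos)"
    by (intro nn_integral_add) measurable
  also have "(\<integral>\<^sup>+ s. indicator {s. ennreal s < t} s * log_mean a (ennreal s) \<partial>leb_pos) =
      (\<integral>\<^sup>+ u. ennreal (a u / u) * ?E u \<partial>leb_pos)"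
    unfolding log_mean_def by (rule nn_integral_swap_less) measurable
  also have "(\<integral>\<^sup>+ s\<in>{s. ennreal s < t}. ennreal (a s) \<partial>leb_pos) + \<dots> =
      (\<integral>\<^sup>+ u. ennreal (a u) * indicator {s. ennreal s < t} u + ennreal (a u / u) * ?E u \<partial>leb_pos)"
    by (intro nn_integral_add[symmetric] borel_measurable_times_ennreal) measurable
  also have "\<dots> = (\<integral>\<^sup>+ u. t * (ennreal (a u / u) * indicator {s. ennreal s < t} u) \<partial>leb_pos)"
  proof (rule nn_integral_cong)
    fix u assume "u \<in> space leb_pos"
    then have u: "0 < u" by simp
    show "ennreal (a u) * indicator {s. ennreal s < t} u + ennreal (a u / u) * ?E u =
        t * (ennreal (a u / u) * indicator {s. ennreal s < t} u)"
    proof (cases "ennreal u < t")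
      case True
      have "ennreal (a u) = ennreal (a u / u) * ennreal u"
        using u young_density_pos[OF a u] by (simp add: ennreal_mult[symmetric])
      then have "ennreal (a u) + ennreal (a u / u) * ?E u = ennreal (a u / u) * (ennreal u + ?E u)"
        by (simp add: distrib_left)
      with True show ?thesis by (simp add: E_le[OF u True] mult.commute)
    qed (simp add: E_ge)
  qed
  also have "\<dots> = cal_A a t"
    unfolding cal_A_def by (rule nn_integral_cmult) measurable
  finally show ?thesis .
qed

section \<open>The rearrangement: equimeasurability and tail integrals\<close>

lemma less_divide_ennreal_iff:
  assumes "0 < t" "0 \<le> v"
  shows "ennreal v < X / ennreal t \<longleftrightarrow> ennreal (v * t) < X"
  using assms
  by (cases X) (auto simp: divide_ennreal ennreal_less_iff field_simps ennreal_top_divide)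

lemma rearrangement_antitone:
  assumes "x \<le> y"
  shows "rearrangement f y \<le> rearrangement f x"
  unfolding rearrangement_def
  using ennreal_leI[OF assms] by (intro Inf_superset_mono) (auto intro: order_trans)

lemma rearrangement_measurable: "rearrangement f \<in> borel_measurable leb_pos"
  by (intro borel_measurable_antitone_leb_pos rearrangement_antitone)

text \<open>The rearrangement is the generalized inverse of the distribution function, and strict
  inequalities transfer exactly because the latter is right-continuous.\<close>

lemma less_rearrangement_iff:
  assumes f [measurable]: "f \<in> borel_measurable leb_pos" and v: "0 < v"
  shows "ennreal v < rearrangement f t \<longleftrightarrow> ennreal t < emeasure leb_pos {x \<in> {0<..}. v < \<bar>f x\<bar>}"
proof -
  have sets: "{x \<in> {0<..}. l < \<bar>f x\<bar>} \<in> sets leb_pos" for l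
  proof -
    have "{x \<in> space leb_pos. l < \<bar>f x\<bar>} \<in> sets leb_pos" by measurable
    then show ?thesis by simp
  qed
  have "rearrangement f t \<le> ennreal v \<longleftrightarrow> emeasure leb_pos {x \<in> {0<..}. v < \<bar>f x\<bar>} \<le> ennreal t"
  proof
    assume "emeasure leb_pos {x \<in> {0<..}. v < \<bar>f x\<bar>} \<le> ennreal t"
    with v show "rearrangement f t \<le> ennreal v"
      unfolding rearrangement_def by (intro Inf_lower) auto
  next
    assume le: "rearrangement f t \<le> ennreal v"
    \<comment> \<open>The infimum need not be attained a priori: it only provides admissible levels
      below each \<open>v + 1 / (n + 1)\<close>. These sets increase to \<open>{v < |f|}\<close>, so
      continuity from below closes the gap.\<close>
    let ?S = "\<lambda>n. {x \<in> {0<..}. v + 1 / (real n + 1) < \<bar>f x\<bar>}"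
    have inc: "incseq ?S"
    proof (rule monoI)
      fix m n :: nat assume "m \<le> n"
      then have "1 / (real n + 1) \<le> 1 / (real m + 1)" by (simp add: frac_le)
      then show "?S m \<subseteq> ?S n" by auto
    qed
    have bound: "emeasure leb_pos (?S n) \<le> ennreal t" for n
    proof -
      have "ennreal v < ennreal (v + 1 / (real n + 1))"
        using v by (simp add: ennreal_less_iff del: ennreal_plus)
      with le have "rearrangement f t < ennreal (v + 1 / (real n + 1))" by simp
      then obtain l where l: "0 < l" "ennreal l < ennreal (v + 1 / (real n + 1))"
        "emeasure leb_pos {x \<in> {0<..}. l < \<bar>f x\<bar>} \<le> ennreal t"
        unfolding rearrangement_def Inf_less_iff by blast
      then have "l < v + 1 / (real n + 1)"
        by (subst (asm) ennreal_less_iff) auto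
      then have "?S n \<subseteq> {x \<in> {0<..}. l < \<bar>f x\<bar>}" by auto
      then show ?thesis
        using l(3) emeasure_mono[OF _ sets] by (blast intro: order_trans)
    qed
    have "(\<Union>n. ?S n) = {x \<in> {0<..}. v < \<bar>f x\<bar>}"
    proof -
      have "\<exists>n. v + 1 / (real n + 1) < y" if "v < y" for y
        using reals_Archimedean[of "y - v"] that by (auto simp: inverse_eq_divide add.commute less_diff_eq)
      moreover have "v < y" if "v + 1 / (real n + 1) < y" for n y
        using that by (rule less_trans[rotated]) simp
      ultimately show ?thesis by auto
    qed
    then have "emeasure leb_pos {x \<in> {0<..}. v < \<bar>f x\<bar>} = (SUP n. emeasure leb_pos (?S n))"
      using SUP_emeasure_incseq[OF _ inc, of leb_pos] sets by (simp add: image_subset_iff)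
    also have "\<dots> \<le> ennreal t"
      using bound by (rule SUP_least)
    finally show "emeasure leb_pos {x \<in> {0<..}. v < \<bar>f x\<bar>} \<le> ennreal t" .
  qed
  then show ?thesis by (simp add: not_le[symmetric])
qed

lemma emeasure_rearrangement:
  assumes "f \<in> borel_measurable leb_pos" "0 < v"
  shows "emeasure leb_pos {t \<in> {0<..}. ennreal v < rearrangement f t} =
    emeasure leb_pos {x \<in> {0<..}. v < \<bar>f x\<bar>}"
  by (simp only: less_rearrangement_iff[OF assms] emeasure_leb_pos_less)

text \<open>Layer cake for \<open>g\<close> cut off to \<open>{g > v}\<close>: its layer at height
  \<open>s\<close> is where \<open>g\<close> exceeds both \<open>s\<close> and \<open>v\<close>.
  Only the distribution function of \<open>g\<close> remains, and for \<open>v > 0\<close> only at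
  positive levels, where \<open>f\<close> and its rearrangement are equimeasurable.\<close>

lemma nn_integral_tail:
  assumes g [measurable]: "g \<in> borel_measurable leb_pos"
  shows "(\<integral>\<^sup>+ x\<in>{x. ennreal v < g x}. g x \<partial>leb_pos) =
    (\<integral>\<^sup>+ s. emeasure leb_pos {x \<in> {0<..}. ennreal (max s v) < g x} \<partial>leb_pos)"
proof -
  let ?w = "\<lambda>x. indicator {x. ennreal v < g x} x :: ennreal"
  have [measurable]: "?w \<in> borel_measurable leb_pos"
    unfolding indicator_def by measurable
  have [measurable]: "(\<lambda>s. ennreal s) \<in> borel_measurable leb_pos"
    by (rule borel_measurable_leb_pos) measurable
  have sets: "{x \<in> {0<..}. ennreal c < g x} \<in> sets leb_pos" for c
    by (rule sets_leb_pos_less) measurable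
  have "(\<integral>\<^sup>+ x\<in>{x. ennreal v < g x}. g x \<partial>leb_pos) =
      (\<integral>\<^sup>+ x. ?w x * (\<integral>\<^sup>+ s\<in>{s. ennreal s < g x}. 1 \<partial>leb_pos) \<partial>leb_pos)"
    by (simp only: set_nn_integral_leb_pos_less) (simp add: mult.commute)
  also have "\<dots> = (\<integral>\<^sup>+ s. 1 * (\<integral>\<^sup>+ x\<in>{x. ennreal s < g x}. ?w x \<partial>leb_pos) \<partial>leb_pos)"
    by (rule nn_integral_swap_less) measurable
  also have "\<dots> = (\<integral>\<^sup>+ s. emeasure leb_pos {x \<in> {0<..}. ennreal (max s v) < g x} \<partial>leb_pos)"
  proof (rule nn_integral_cong)
    fix s
    have "(\<integral>\<^sup>+ x\<in>{x. ennreal s < g x}. ?w x \<partial>leb_pos) =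
        (\<integral>\<^sup>+ x. indicator {x \<in> {0<..}. ennreal (max s v) < g x} x \<partial>leb_pos)"
    proof (rule nn_integral_cong)
      fix x
      have "ennreal (max s v) < g x \<longleftrightarrow> ennreal s < g x \<and> ennreal v < g x"
        by (cases s v rule: le_cases) (auto simp: max_def dest: ennreal_leI intro: le_less_trans)
      moreover assume "x \<in> space leb_pos"
      ultimately show "?w x * indicator {x. ennreal s < g x} x =
          indicator {x \<in> {0<..}. ennreal (max s v) < g x} x"
        by (auto simp: indicator_def)
    qed
    then show "1 * (\<integral>\<^sup>+ x\<in>{x. ennreal s < g x}. ?w x \<partial>leb_pos) =
        emeasure leb_pos {x \<in> {0<..}. ennreal (max s v) < g x}"
      using sets by simp
  qed
  finally show ?thesis .
qed

lemma nn_integral_tail_rearrangement: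
  assumes f [measurable]: "f \<in> borel_measurable leb_pos" and v: "0 < v"
  shows "(\<integral>\<^sup>+ x\<in>{x. ennreal v < rearrangement f x}. rearrangement f x \<partial>leb_pos) =
    (\<integral>\<^sup>+ x\<in>{x. ennreal v < ennreal \<bar>f x\<bar>}. ennreal \<bar>f x\<bar> \<partial>leb_pos)"
proof -
  have g: "(\<lambda>x. ennreal \<bar>f x\<bar>) \<in> borel_measurable leb_pos" by measurable
  have "emeasure leb_pos {x \<in> {0<..}. ennreal (max s v) < rearrangement f x} =
      emeasure leb_pos {x \<in> {0<..}. ennreal (max s v) < ennreal \<bar>f x\<bar>}" for s
    using v by (subst emeasure_rearrangement[OF f]) (auto simp: ennreal_less_iff less_max_iff_disj)
  then show ?thesis
    by (simp only: nn_integral_tail rearrangement_measurable g)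
qed

section \<open>Weak-type estimates for the Hardy average\<close>

lemma hardy_avg_measurable: "hardy_avg g \<in> borel_measurable leb_pos"
proof -
  have [measurable]: "(\<lambda>t. \<integral>\<^sup>+ s\<in>{0<..<t}. g s \<partial>leb_pos) \<in> borel_measurable leb_pos"
    by (intro borel_measurable_monotone_leb_pos nn_integral_mono) (auto simp: indicator_def)
  have [measurable]: "(\<lambda>s. ennreal s) \<in> borel_measurable leb_pos"
    by (rule borel_measurable_leb_pos) measurable
  show ?thesis unfolding hardy_avg_def[abs_def] by measurable
qed

text \<open>Every \<open>t\<close> with \<open>v * t < ?J\<close> lies in the level set. If
  \<open>g t > v\<close>, the average of the nonincreasing \<open>g\<close> over
  \<open>(0,t)\<close> is at least \<open>g t\<close>. Otherwise \<open>{g > v}\<close> lies inside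
  \<open>(0,t)\<close>, so the integral up to \<open>t\<close> is at least
  \<open>?J\<close>.\<close>

lemma hardy_avg_level_lower:
  assumes anti: "\<And>x y. 0 < x \<Longrightarrow> x \<le> y \<Longrightarrow> g y \<le> g x" and v: "0 < v"
  shows "(\<integral>\<^sup>+ x\<in>{x. ennreal v < g x}. g x \<partial>leb_pos) / ennreal v \<le>
    emeasure leb_pos {t \<in> {0<..}. ennreal v < hardy_avg g t}"
proof -
  let ?J = "\<integral>\<^sup>+ x\<in>{x. ennreal v < g x}. g x \<partial>leb_pos"
  have "{t \<in> {0<..}. ennreal t < ?J / ennreal v} \<subseteq> {t \<in> {0<..}. ennreal v < hardy_avg g t}"
  proof (safe)
    fix t :: real assume t: "0 < t" and "ennreal t < ?J / ennreal v"
    with v have J: "ennreal (v * t) < ?J" by (simp add: less_divide_ennreal_iff mult.commute)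
    show "ennreal v < hardy_avg g t"
    proof (cases "ennreal v < g t")
      case True
      have sub: "{0<..<t} \<in> sets leb_pos" by (intro sets_leb_pos_borel) auto
      have "g t * ennreal t = (\<integral>\<^sup>+ s. g t * indicator {0<..<t} s \<partial>leb_pos)"
        using t sub by (subst nn_integral_cmult_indicator) (auto simp: emeasure_leb_pos_borel subset_iff)
      also have "\<dots> \<le> (\<integral>\<^sup>+ s\<in>{0<..<t}. g s \<partial>leb_pos)"
        using anti by (intro nn_integral_mono) (auto simp: indicator_def)
      finally have "g t * ennreal t / ennreal t \<le> hardy_avg g t"
        unfolding hardy_avg_def by (rule divide_right_mono_ennreal)
      with t True show ?thesis by (simp add: ennreal_mult_divide_eq)
    next
      case False
      have "?J \<le> (\<integral>\<^sup>+ s\<in>{0<..<t}. g s \<partial>leb_pos)"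
      proof (rule nn_integral_mono)
        fix x assume "x \<in> space leb_pos"
        moreover have "\<not> ennreal v < g x" if "t \<le> x"
          using anti[OF t that] False by auto
        ultimately show "g x * indicator {x. ennreal v < g x} x \<le> g x * indicator {0<..<t} x"
          by (auto simp: indicator_def not_less)
      qed
      with J have "ennreal (v * t) < (\<integral>\<^sup>+ s\<in>{0<..<t}. g s \<partial>leb_pos)" by simp
      with t v show ?thesis by (simp add: hardy_avg_def less_divide_ennreal_iff)
    qed
  qed
  then have "emeasure leb_pos {t \<in> {0<..}. ennreal t < ?J / ennreal v} \<le>
      emeasure leb_pos {t \<in> {0<..}. ennreal v < hardy_avg g t}"
    by (intro emeasure_mono sets_leb_pos_less hardy_avg_measurable borel_measurable_const)
  then show ?thesis by (simp only: emeasure_leb_pos_less)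
qed

text \<open>On \<open>(0,t)\<close> the function \<open>g\<close> is at most its part above level
  \<open>v\<close> plus the constant \<open>v\<close>. The constant uses up one \<open>v\<close> of
  the threshold \<open>2 * v\<close>, and what is left gives \<open>v * t < ?J\<close>. The factor
  1/2 of the theorem originates here.\<close>

lemma hardy_avg_level_upper:
  assumes g [measurable]: "g \<in> borel_measurable leb_pos" and v: "0 < v"
  shows "emeasure leb_pos {t \<in> {0<..}. ennreal (2 * v) < hardy_avg g t} \<le>
    (\<integral>\<^sup>+ x\<in>{x. ennreal v < g x}. g x \<partial>leb_pos) / ennreal v"
proof -
  let ?J = "\<integral>\<^sup>+ x\<in>{x. ennreal v < g x}. g x \<partial>leb_pos"
  have [measurable]: "(\<lambda>s. ennreal s) \<in> borel_measurable leb_pos"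
    by (rule borel_measurable_leb_pos) measurable
  have "{t \<in> {0<..}. ennreal (2 * v) < hardy_avg g t} \<subseteq> {t \<in> {0<..}. ennreal t < ?J / ennreal v}"
  proof safe
    fix t :: real assume t: "0 < t" and *: "ennreal (2 * v) < hardy_avg g t"
    have sub [measurable]: "{0<..<t} \<in> sets leb_pos" by (intro sets_leb_pos_borel) auto
    from * t v have "ennreal (2 * v * t) < (\<integral>\<^sup>+ s\<in>{0<..<t}. g s \<partial>leb_pos)"
      by (simp add: hardy_avg_def less_divide_ennreal_iff)
    also have "\<dots> \<le> (\<integral>\<^sup>+ s. g s * indicator {x. ennreal v < g x} s + ennreal v * indicator {0<..<t} s \<partial>leb_pos)"
      by (intro nn_integral_mono) (auto simp: indicator_def not_less)
    also have "\<dots> = ?J + (\<integral>\<^sup>+ s. ennreal v * indicator {0<..<t} s \<partial>leb_pos)"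
      by (intro nn_integral_add) (unfold indicator_def[of "{x. ennreal v < g x}"], measurable)
    also have "(\<integral>\<^sup>+ s. ennreal v * indicator {0<..<t} s \<partial>leb_pos) = ennreal (v * t)"
      using t v sub by (subst nn_integral_cmult_indicator) (auto simp: emeasure_leb_pos_borel subset_iff ennreal_mult)
    finally have "ennreal (2 * v * t) < ?J + ennreal (v * t)" .
    \<comment> \<open>Cancellation is legitimate since \<open>v * t\<close> is finite, even when
      \<open>?J\<close> is infinite.\<close>
    then have "ennreal (t * v) < ?J"
      using t v by (cases ?J) (auto simp: ennreal_less_iff ennreal_plus[symmetric] mult.commute simp del: ennreal_plus)
    with t v show "ennreal t < ?J / ennreal v" by (simp add: less_divide_ennreal_iff)
  qed
  moreover have "{t \<in> {0<..}. ennreal t < ?J / ennreal v} \<in> sets leb_pos"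
    by (rule sets_leb_pos_less) measurable
  ultimately have "emeasure leb_pos {t \<in> {0<..}. ennreal (2 * v) < hardy_avg g t} \<le>
      emeasure leb_pos {t \<in> {0<..}. ennreal t < ?J / ennreal v}"
    by (rule emeasure_mono)
  then show ?thesis by (simp only: emeasure_leb_pos_less)
qed

section \<open>Modular inequalities and the norms\<close>

text \<open>The exchange with weight \<open>g / l\<close> produces the tail integral divided by
  \<open>l\<close>; the \<open>1 / s\<close> in the density \<open>a s / s\<close> joins it to form
  \<open>1 / (s * l)\<close>, leaving \<open>a s\<close> alone as on the Hardy side.\<close>

lemma nn_integral_cal_A:
  assumes a: "young_density a" and g [measurable]: "g \<in> borel_measurable leb_pos" and l: "0 < l"
  shows "(\<integral>\<^sup>+ x. cal_A a (g x / ennreal l) \<partial>leb_pos) =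
    (\<integral>\<^sup>+ s. ennreal (a s) * ((\<integral>\<^sup>+ x\<in>{x. ennreal (s * l) < g x}. g x \<partial>leb_pos) / ennreal (s * l)) \<partial>leb_pos)"
proof -
  note [measurable] = quotient_measurable[OF a]
  have "(\<integral>\<^sup>+ x. cal_A a (g x / ennreal l) \<partial>leb_pos) =
      (\<integral>\<^sup>+ s. ennreal (a s / s) * (\<integral>\<^sup>+ x\<in>{x. ennreal s < g x / ennreal l}. (g x / ennreal l) \<partial>leb_pos) \<partial>leb_pos)"
    unfolding cal_A_def by (rule nn_integral_swap_less) measurable
  also have "\<dots> = (\<integral>\<^sup>+ s. ennreal (a s) *
      ((\<integral>\<^sup>+ x\<in>{x. ennreal (s * l) < g x}. g x \<partial>leb_pos) / ennreal (s * l)) \<partial>leb_pos)"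
  proof (rule nn_integral_cong)
    fix s assume "s \<in> space leb_pos"
    then have s: "0 < s" by simp
    let ?J = "\<integral>\<^sup>+ x\<in>{x. ennreal (s * l) < g x}. g x \<partial>leb_pos"
    have [measurable]: "(\<lambda>x. indicator {x. ennreal (s * l) < g x} x :: ennreal) \<in> borel_measurable leb_pos"
      unfolding indicator_def by measurable
    have "(\<integral>\<^sup>+ x\<in>{x. ennreal s < g x / ennreal l}. (g x / ennreal l) \<partial>leb_pos) =
        (\<integral>\<^sup>+ x. g x * indicator {x. ennreal (s * l) < g x} x / ennreal l \<partial>leb_pos)"
      using s l by (intro nn_integral_cong)
        (simp add: less_divide_ennreal_iff, simp add: divide_ennreal_def ac_simps)
    also have "\<dots> = ?J / ennreal l"
      by (rule nn_integral_divide) measurable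
    finally have 1: "(\<integral>\<^sup>+ x\<in>{x. ennreal s < g x / ennreal l}. (g x / ennreal l) \<partial>leb_pos) = ?J / ennreal l" .
    have "ennreal (a s / s) = ennreal (a s) * inverse (ennreal s)"
      using s young_density_pos[OF a s] by (simp add: inverse_ennreal ennreal_mult'[symmetric] divide_inverse)
    moreover have "inverse (ennreal (s * l)) = inverse (ennreal s) * inverse (ennreal l)"
      using s l by (simp add: inverse_ennreal ennreal_mult[symmetric])
    ultimately show "ennreal (a s / s) * (\<integral>\<^sup>+ x\<in>{x. ennreal s < g x / ennreal l}. (g x / ennreal l) \<partial>leb_pos) =
        ennreal (a s) * (?J / ennreal (s * l))"
      unfolding 1 by (simp add: divide_ennreal_def ac_simps)
  qed
  finally show ?thesis .
qed

lemma nn_integral_young_of: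
  assumes a: "young_density a" and g [measurable]: "g \<in> borel_measurable leb_pos" and l: "0 < l"
  shows "(\<integral>\<^sup>+ x. young_of a (g x / ennreal l) \<partial>leb_pos) =
    (\<integral>\<^sup>+ s. ennreal (a s) * emeasure leb_pos {x \<in> {0<..}. ennreal (s * l) < g x} \<partial>leb_pos)"
proof -
  note [measurable] = young_density_measurable[OF a]
  have "(\<integral>\<^sup>+ x. young_of a (g x / ennreal l) \<partial>leb_pos) =
      (\<integral>\<^sup>+ s. ennreal (a s) * (\<integral>\<^sup>+ x\<in>{x. ennreal s < g x / ennreal l}. 1 \<partial>leb_pos) \<partial>leb_pos)"
    using nn_integral_swap_less[of "\<lambda>s. ennreal (a s)" "\<lambda>_. 1" "\<lambda>x. g x / ennreal l"]
    by (simp add: young_of_def)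
  also have "\<dots> = (\<integral>\<^sup>+ s. ennreal (a s) * emeasure leb_pos {x \<in> {0<..}. ennreal (s * l) < g x} \<partial>leb_pos)"
  proof (intro nn_integral_cong arg_cong2[where f = "(*)"] refl)
    fix s assume "s \<in> space leb_pos"
    then have s: "0 < s" by simp
    have "{x \<in> {0<..}. ennreal (s * l) < g x} \<in> sets leb_pos"
      by (rule sets_leb_pos_less) measurable
    with s l show "(\<integral>\<^sup>+ x\<in>{x. ennreal s < g x / ennreal l}. 1 \<partial>leb_pos) =
        emeasure leb_pos {x \<in> {0<..}. ennreal (s * l) < g x}"
      by (subst set_nn_integral_leb_pos_one) (simp_all add: less_divide_ennreal_iff)
  qed
  finally show ?thesis .
qed

lemma nn_integral_cal_A_le:
  assumes a: "young_density a" and f [measurable]: "f \<in> borel_measurable leb_pos" and l: "0 < l"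
  shows "(\<integral>\<^sup>+ x. cal_A a (ennreal \<bar>f x\<bar> / ennreal l) \<partial>leb_pos) \<le>
    (\<integral>\<^sup>+ t. young_of a (hardy_avg (rearrangement f) t / ennreal l) \<partial>leb_pos)"
proof -
  have g: "(\<lambda>x. ennreal \<bar>f x\<bar>) \<in> borel_measurable leb_pos" by measurable
  show ?thesis
    unfolding nn_integral_cal_A[OF a g l] nn_integral_young_of[OF a hardy_avg_measurable l]
  proof (intro nn_integral_mono mult_left_mono)
    fix s assume "s \<in> space leb_pos"
    with l have "0 < s * l" by simp
    then show "(\<integral>\<^sup>+ x\<in>{x. ennreal (s * l) < ennreal \<bar>f x\<bar>}. ennreal \<bar>f x\<bar> \<partial>leb_pos) / ennreal (s * l) \<le>
        emeasure leb_pos {x \<in> {0<..}. ennreal (s * l) < hardy_avg (rearrangement f) x}"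
      using hardy_avg_level_lower[of "rearrangement f" "s * l", OF rearrangement_antitone]
      by (simp add: nn_integral_tail_rearrangement[OF f, symmetric])
  qed simp
qed

text \<open>Doubling the scale turns the level \<open>s * l\<close> into \<open>2 * (s * l)\<close>,
  exactly the threshold of \<open>hardy_avg_level_upper\<close>.\<close>

lemma nn_integral_young_of_le:
  assumes a: "young_density a" and f [measurable]: "f \<in> borel_measurable leb_pos" and l: "0 < l"
  shows "(\<integral>\<^sup>+ t. young_of a (hardy_avg (rearrangement f) t / ennreal (2 * l)) \<partial>leb_pos) \<le>
    (\<integral>\<^sup>+ x. cal_A a (ennreal \<bar>f x\<bar> / ennreal l) \<partial>leb_pos)"
proof -
  have g: "(\<lambda>x. ennreal \<bar>f x\<bar>) \<in> borel_measurable leb_pos" by measurable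
  have l2: "0 < 2 * l" using l by simp
  show ?thesis
    unfolding nn_integral_cal_A[OF a g l] nn_integral_young_of[OF a hardy_avg_measurable l2]
  proof (intro nn_integral_mono mult_left_mono)
    fix s assume "s \<in> space leb_pos"
    with l have "0 < s * l" by simp
    then show "emeasure leb_pos {x \<in> {0<..}. ennreal (s * (2 * l)) < hardy_avg (rearrangement f) x} \<le>
        (\<integral>\<^sup>+ x\<in>{x. ennreal (s * l) < ennreal \<bar>f x\<bar>}. ennreal \<bar>f x\<bar> \<partial>leb_pos) / ennreal (s * l)"
      using hardy_avg_level_upper[OF rearrangement_measurable, of "s * l" f]
      by (simp add: nn_integral_tail_rearrangement[OF f, symmetric] mult.left_commute)
  qed simp
qed

text \<open>Each scale admissible for the Hardy average is admissible for \<open>f\<close>, so the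
  second infimum runs over a larger set.\<close>

lemma rho_cal_A_le:
  assumes "young_density a" "f \<in> borel_measurable leb_pos"
  shows "rho (cal_A a) f \<le> rho_Gamma (young_of a) f"
  unfolding rho_def rho_Gamma_def orlicz_norm_def
  using nn_integral_cal_A_le[OF assms] by (intro Inf_superset_mono) (auto intro: order_trans)

text \<open>If \<open>l\<close> is admissible for \<open>f\<close>, then \<open>2 * l\<close> is
  admissible for the Hardy average. With no admissible \<open>l\<close> the right-hand side is
  infinite.\<close>

lemma half_rho_Gamma_le:
  assumes "young_density a" "f \<in> borel_measurable leb_pos"
  shows "ennreal (1/2) * rho_Gamma (young_of a) f \<le> rho (cal_A a) f"
  unfolding rho_def orlicz_norm_def
proof (rule Inf_greatest, safe)
  fix l :: real
  assume l: "0 < l" and le: "(\<integral>\<^sup>+ x. cal_A a (ennreal \<bar>f x\<bar> / ennreal l) \<partial>leb_pos) \<le> 1"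
  have "rho_Gamma (young_of a) f \<le> ennreal (2 * l)"
    unfolding rho_Gamma_def orlicz_norm_def
    using l order_trans[OF nn_integral_young_of_le[OF assms l] le]
    by (intro Inf_lower CollectI exI[of _ "2 * l"]) auto
  then have "ennreal (1/2) * rho_Gamma (young_of a) f \<le> ennreal (1/2) * ennreal (2 * l)"
    by (rule mult_left_mono) simp
  also have "\<dots> = ennreal l"
    using l by (subst ennreal_mult[symmetric]) auto
  finally show "ennreal (1/2) * rho_Gamma (young_of a) f \<le> ennreal l" .
qed

theorem theorem1p1:
  fixes a :: "real \<Rightarrow> real" and A :: "ennreal \<Rightarrow> ennreal"
  assumes "young_density a" and "A = young_of a"
  shows "(\<forall>k>0. (\<integral>\<^sup>+ t. A (ennreal (k / (1 + t))) \<partial>leb_pos) < \<infinity> \<longleftrightarrow>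
                (\<integral>\<^sup>+ s\<in>{0<..<k}. A (ennreal s) / ennreal (s^2) \<partial>leb_pos) < \<infinity>) \<and>
         ((\<exists>k>0. (\<integral>\<^sup>+ t. A (ennreal (k / (1 + t))) \<partial>leb_pos) < \<infinity>) \<longrightarrow>
            young_function (cal_A a) \<and>
            (\<forall>f \<in> borel_measurable leb_pos.
               ennreal (1/2) * rho_Gamma A f \<le> rho (cal_A a) f \<and>
               rho (cal_A a) f \<le> rho_Gamma A f))"
proof (intro conjI allI impI ballI)
  fix k :: real assume k: "0 < k"
  then show "(\<integral>\<^sup>+ t. A (ennreal (k / (1 + t))) \<partial>leb_pos) < \<infinity> \<longleftrightarrow>
      (\<integral>\<^sup>+ s\<in>{0<..<k}. A (ennreal s) / ennreal (s^2) \<partial>leb_pos) < \<infinity>"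
    unfolding assms(2) nn_integral_young_of_shift_eq[OF assms(1) k]
    by (auto simp: ennreal_mult_less_top)
next
  assume "\<exists>k>0. (\<integral>\<^sup>+ t. A (ennreal (k / (1 + t))) \<partial>leb_pos) < \<infinity>"
  \<comment> \<open>Finiteness for one \<open>k\<close> yields finiteness at every \<open>t\<close>,
    which is what makes \<open>cal_density\<close> a genuine real density of
    \<open>cal_A\<close>.\<close>
  then have "log_mean a (ennreal t) < \<infinity>" for t
    using log_mean_finite[OF assms(1)] assms(2) by blast
  then show "young_function (cal_A a)"
    unfolding young_function_def
    using young_density_cal_density[OF assms(1)] young_of_cal_density[OF assms(1)] by fastforce
next
  fix f :: "real \<Rightarrow> real" assume f: "f \<in> borel_measurable leb_pos"
  show "ennreal (1/2) * rho_Gamma A f \<le> rho (cal_A a) f" "rho (cal_A a) f \<le> rho_Gamma A f"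
    unfolding assms(2) by (rule half_rho_Gamma_le[OF assms(1) f], rule rho_cal_A_le[OF assms(1) f])
qed

end
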